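(* Let $Y=\mathbb{P}^{n_1}\times\cdots\times\mathbb{P}^{n_k}$, let $X=\nu(Y)$ be its Segre embedding and let $q\in\sigma_2^0(X)$. Then $|\mathcal{S}(Y,q)|>1$ if and only if the concise Segre $X_q$ of $q$ is $X_q=\nu(\mathbb{P}^1\times\mathbb{P}^1)$.
   Context: Work over an algebraically closed field of characteristic $0$. For $Y=\mathbb{P}^{n_1}\times\cdots\times\mathbb{P}^{n_k}$ let $\nu:Y\to\mathbb{P}^N$, $N=\prod(n_i+1)-1$, be the Segre embedding and $X=\nu(Y)$. $\langle\cdot\rangle$ denotes projective linear span. The rank $r_X(q)$ of $q\in\mathbb{P}^N$ is the minimal cardinality of a finite set $S\subset X$ with $q\in\langle S\rangle$. $\sigma_2^0(X)$ is the set of points of $X$-rank exactly $2$. $\mathcal{S}(Y,q)$ is the set of all finite subsets $A\subset Y$ with $\sharp A=r_X(q)$ and $q\in\langle\nu(A)\rangle$. For every $q$ there is a unique minimal multiprojective subspace $Y'\subseteq Y$ (product of linear subspaces of the factors) with $q\in\langle\nu(Y')\rangle$, and $\mathcal{S}(Y,q)=\mathcal{S}(Y',q)$; $X_q=\nu(Y')$, where factors of $Y'$ consisting of a single point are dropped, is called the concise Segre of $q$. *)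

theory Defs
  imports
    "HOL-Library.Function_Algebras"
    "HOL-Computational_Algebra.Polynomial"
begin

section \<open>Coordinate spaces and projective spaces\<close>

definition vscale :: "'a::field \<Rightarrow> ('i \<Rightarrow> 'a) \<Rightarrow> 'i \<Rightarrow> 'a" where
  "vscale c v = (\<lambda>i. c * v i)"

global_interpretation fun_space: vector_space "vscale :: 'a::field \<Rightarrow> ('i \<Rightarrow> 'a) \<Rightarrow> 'i \<Rightarrow> 'a"
  by unfold_locales (auto simp: vscale_def fun_eq_iff algebra_simps)

text \<open>
  The space of column vectors with entries indexed by \<open>I\<close> is the set of functions vanishing outside
  \<open>I\<close>; in this way spaces of different dimensions live in one type.
\<close>

definition coord_space :: "'i set \<Rightarrow> ('i \<Rightarrow> 'a::field) set" where
  "coord_space I = {v. \<forall>i. i \<notin> I \<longrightarrow> v i = 0}"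

text \<open>A point of a projective space is a line through the origin, as a set of vectors (including 0).\<close>

type_synonym ('i, 'a) point = "('i \<Rightarrow> 'a) set"

definition proj_of :: "('i \<Rightarrow> 'a::field) set \<Rightarrow> ('i, 'a) point set" where
  "proj_of W = {fun_space.span {v} | v. v \<in> W \<and> v \<noteq> 0}"

definition proj_space :: "nat \<Rightarrow> (nat, 'a::field) point set" where
  "proj_space n = proj_of (coord_space {..n})"

definition proj_span :: "('i, 'a::field) point set \<Rightarrow> ('i, 'a) point set" where
  "proj_span S = proj_of (fun_space.span (\<Union>S))"

definition linear_subspace :: "('i, 'a::field) point set \<Rightarrow> bool" where
  "linear_subspace L \<longleftrightarrow> (\<exists>W. fun_space.subspace W \<and> L = proj_of W)"

definition projective_line :: "('i, 'a::field) point set \<Rightarrow> bool" where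
  "projective_line L \<longleftrightarrow> (\<exists>W. fun_space.subspace W \<and> fun_space.dim W = 2 \<and> L = proj_of W)"

section \<open>Multiprojective spaces and the Segre embedding\<close>

text \<open>
  A point of a product of \<open>k\<close> projective spaces is a list of \<open>k\<close> points, and the product of a list
  of sets is \<^const>\<open>listset\<close>.
\<close>

definition multiproj_space :: "nat list \<Rightarrow> (nat, 'a::field) point list set" where
  "multiproj_space ns = listset (map proj_space ns)"

text \<open>
  The homogeneous coordinates of the target of the Segre embedding are labelled by the
  multi-indices \<open>[a\<^sub>1, \<dots>, a\<^sub>k]\<close> with \<open>a\<^sub>i \<le> n\<^sub>i\<close>, of which there are \<open>N + 1 = \<Prod>(n\<^sub>i + 1)\<close>.
\<close>

definition segre_ambient :: "nat list \<Rightarrow> (nat list, 'a::field) point set" where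
  "segre_ambient ns = proj_of (coord_space (listset (map (\<lambda>n. {..n}) ns)))"

definition tensor :: "(nat \<Rightarrow> 'a::field) list \<Rightarrow> nat list \<Rightarrow> 'a" where
  "tensor vs = (\<lambda>as. if length as = length vs then \<Prod>i<length vs. (vs ! i) (as ! i) else 0)"

text \<open>
  The members of \<open>listset ys\<close> are the choices of a vector on each of the lines in \<open>ys\<close>. Their
  tensors are all proportional, so that their span is the line through the tensor of
  any choice of nonzero representatives, see \<open>segre_representatives\<close> below.
\<close>

definition segre :: "(nat, 'a::field) point list \<Rightarrow> (nat list, 'a) point" where
  "segre ys = fun_space.span (tensor ` listset ys)"

lemma mem_listset_iff: "vs \<in> listset ys \<longleftrightarrow> list_all2 (\<in>) vs ys"
proof (induction ys arbitrary: vs)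
  case (Cons y ys)
  then show ?case by (cases vs) (auto simp: set_Cons_def)
qed simp

lemma segre_representatives:
  fixes vs :: "(nat \<Rightarrow> 'a::field) list"
  shows "segre (map (\<lambda>v. fun_space.span {v}) vs) = fun_space.span {tensor vs}"
proof -
  have "tensor ws \<in> fun_space.span {tensor vs}"
    if "list_all2 (\<in>) ws (map (\<lambda>v. fun_space.span {v}) vs)" for ws
  proof -
    from that have len: "length ws = length vs" by (auto dest: list_all2_lengthD)
    have "\<exists>c. ws ! i = vscale c (vs ! i)" if "i < length vs" for i
    proof -
      have "ws ! i \<in> fun_space.span {vs ! i}"
        using list_all2_nthD2[OF \<open>list_all2 _ _ _\<close>, of i] that by simp
      then show ?thesis by (simp add: fun_space.span_singleton image_iff)
    qed
    then obtain c where c: "\<And>i. i < length vs \<Longrightarrow> ws ! i = vscale (c i) (vs ! i)" by metis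
    have "tensor ws as = (\<Prod>i<length vs. c i) * tensor vs as" for as
      using c len by (simp add: tensor_def vscale_def prod.distrib)
    then have "tensor ws = vscale (\<Prod>i<length vs. c i) (tensor vs)"
      by (simp add: vscale_def fun_eq_iff)
    then show ?thesis by (simp add: fun_space.span_scale fun_space.span_base)
  qed
  moreover have "vs \<in> listset (map (\<lambda>v. fun_space.span {v}) vs)"
    by (auto simp: mem_listset_iff list_all2_conv_all_nth fun_space.span_base)
  ultimately have "tensor ` listset (map (\<lambda>v. fun_space.span {v}) vs) \<subseteq> fun_space.span {tensor vs}"
    and "{tensor vs} \<subseteq> tensor ` listset (map (\<lambda>v. fun_space.span {v}) vs)"
    by (auto simp: mem_listset_iff)
  then show ?thesis
    unfolding segre_def
    by (meson fun_space.span_minimal fun_space.span_mono fun_space.subspace_span subset_antisym)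
qed

section \<open>Rank and the sets evincing it\<close>

definition xrank :: "('i, 'a::field) point set \<Rightarrow> ('i, 'a) point \<Rightarrow> nat" where
  "xrank X q = (LEAST r. \<exists>S. finite S \<and> S \<subseteq> X \<and> card S = r \<and> q \<in> proj_span S)"

definition sigma2_0 :: "nat list \<Rightarrow> (nat list, 'a::field) point set" where
  "sigma2_0 ns = {q \<in> segre_ambient ns. xrank (segre ` multiproj_space ns) q = 2}"

definition evincing_sets ::
  "nat list \<Rightarrow> (nat list, 'a::field) point \<Rightarrow> (nat, 'a) point list set set" where
  "evincing_sets ns q =
     {A. finite A \<and> A \<subseteq> multiproj_space ns \<and> card A = xrank (segre ` multiproj_space ns) q \<and>
         q \<in> proj_span (segre ` A)}"

section \<open>The concise Segre of a point\<close>

text \<open>A multiprojective subspace is represented by the list of its factors.\<close>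

definition multiproj_subspace :: "nat list \<Rightarrow> (nat, 'a::field) point set list \<Rightarrow> bool" where
  "multiproj_subspace ns Ls \<longleftrightarrow>
     list_all2 (\<lambda>L n. linear_subspace L \<and> L \<subseteq> proj_space n) Ls ns"

definition minimal_multiproj_subspace ::
  "nat list \<Rightarrow> (nat list, 'a::field) point \<Rightarrow> (nat, 'a) point set list \<Rightarrow> bool" where
  "minimal_multiproj_subspace ns q Ls \<longleftrightarrow>
     multiproj_subspace ns Ls \<and> q \<in> proj_span (segre ` listset Ls) \<and>
     (\<forall>Ms. multiproj_subspace ns Ms \<and> q \<in> proj_span (segre ` listset Ms) \<and>
           listset Ms \<subseteq> listset Ls \<longrightarrow> Ms = Ls)"

text \<open>The multiprojective subspace below exists and is unique for every \<open>q \<in> segre_ambient ns\<close>.\<close>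

definition concise_factors ::
  "nat list \<Rightarrow> (nat list, 'a::field) point \<Rightarrow> (nat, 'a) point set list" where
  "concise_factors ns q = (THE Ls. minimal_multiproj_subspace ns q Ls)"

text \<open>
  Dropping the one-point factors changes the length of the multi-indices, so the concise
  Segre lives in the target of the Segre embedding of the remaining factors.
\<close>

definition concise_segre ::
  "nat list \<Rightarrow> (nat list, 'a::field) point \<Rightarrow> (nat list, 'a) point set" where
  "concise_segre ns q =
     segre ` listset (filter (\<lambda>L. \<not> is_singleton L) (concise_factors ns q))"

text \<open>
  As the concise Segre is built from subspaces of the given factors, each
  copy of the projective line is some projective line, without a preferred choice of coordinates.
\<close>

definition is_segre_P1_P1 :: "(nat list, 'a::field) point set \<Rightarrow> bool" where
  "is_segre_P1_P1 X \<longleftrightarrow>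
     (\<exists>L M. projective_line L \<and> projective_line M \<and> X = segre ` listset [L, M])"

end

theory Submission
  imports Defs
begin

text \<open>
  Write \<open>q\<close> as the class of \<open>w = u\<^sub>1 \<otimes> \<dots> \<otimes> u\<^sub>k + v\<^sub>1 \<otimes> \<dots> \<otimes> v\<^sub>k\<close>. As \<open>w\<close> has rank 2, for each position \<open>i\<close>
  the products of the remaining \<open>u\<^sub>j\<close> and of the remaining \<open>v\<^sub>j\<close> are not proportional. Hence the fibres
  of \<open>w\<close> in direction \<open>i\<close> span both \<open>u\<^sub>i\<close> and \<open>v\<^sub>i\<close>, the \<open>i\<close>-th concise factor is the projective space of
  \<open>span {u\<^sub>i, v\<^sub>i}\<close>, and the concise Segre has as many factors as there are positions with \<open>u\<^sub>i\<close> and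
  \<open>v\<^sub>i\<close> independent; they are all lines, and there are at least two of them.

  If there are exactly two, then \<open>w\<close> is a \<open>2 \<times> 2\<close> matrix of rank 2 up to a common factor, which
  is a sum of two matrices of rank one in many ways. If there are at least three, let
  \<open>x\<^sub>1 \<otimes> \<dots> \<otimes> x\<^sub>k + y\<^sub>1 \<otimes> \<dots> \<otimes> y\<^sub>k\<close> be another decomposition and expand \<open>u\<^sub>i\<close> and \<open>v\<^sub>i\<close> in \<open>x\<^sub>i\<close> and \<open>y\<^sub>i\<close> at one such
  position \<open>i\<close>. Comparing coefficients makes the products of the remaining \<open>x\<^sub>j\<close> and of the remaining
  \<open>y\<^sub>j\<close> linear combinations of those of the \<open>u\<^sub>j\<close> and of the \<open>v\<^sub>j\<close>. The latter differ in two further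
  positions, so a combination with both coefficients nonzero is not a product, and therefore
  the two decompositions agree up to order.
\<close>

section \<open>Proportional vectors and products of vectors\<close>

text \<open>Linear independence of two vectors as a nonzero 2 x 2 minor: symmetric, false as soon as
  one vector is 0, and ready for Cramer's rule. The index type stays general because it is applied
  to single vectors as well as to products of several.\<close>

definition nonprop :: "('s \<Rightarrow> 'a::field) \<Rightarrow> ('s \<Rightarrow> 'a) \<Rightarrow> bool" where
  "nonprop f g \<longleftrightarrow> (\<exists>s t. f s * g t \<noteq> f t * g s)"

lemma nonprop_sym: "nonprop f g \<Longrightarrow> nonprop g f"
  unfolding nonprop_def by (metis mult.commute)

lemma nonprop_vscale: "nonprop f g \<Longrightarrow> a \<noteq> 0 \<Longrightarrow> b \<noteq> 0 \<Longrightarrow> nonprop (vscale a f) (vscale b g)"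
proof -
  assume "nonprop f g" and ab: "a \<noteq> 0" "b \<noteq> 0"
  then obtain s t where "f s * g t \<noteq> f t * g s" by (auto simp: nonprop_def)
  with ab have "a * b * (f s * g t) \<noteq> a * b * (f t * g s)" by simp
  then show "nonprop (vscale a f) (vscale b g)"
    unfolding nonprop_def vscale_def by (intro exI[of _ s] exI[of _ t]) (simp add: mult_ac)
qed

lemma not_nonprop_vscale: "\<not> nonprop (vscale c g) g"
  by (simp add: nonprop_def vscale_def mult.assoc mult.commute mult.left_commute)

lemma not_nonpropE:
  assumes "\<not> nonprop f g" and "g \<noteq> 0"
  obtains c where "f = vscale c g"
proof -
  from \<open>g \<noteq> 0\<close> obtain t where t: "g t \<noteq> 0" by (auto simp: fun_eq_iff)
  have "f = vscale (f t / g t) g"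
    using assms(1) t by (auto simp: nonprop_def vscale_def fun_eq_iff field_simps)
  then show thesis by (rule that)
qed

lemma nonprop_neq_0: "nonprop f g \<Longrightarrow> f \<noteq> 0" "nonprop f g \<Longrightarrow> g \<noteq> 0"
  by (auto simp: nonprop_def)

lemma nonprop_iff_span:
  assumes "u \<noteq> 0" and "v \<noteq> 0"
  shows "nonprop u v \<longleftrightarrow> fun_space.span {u} \<noteq> fun_space.span {v}"
proof
  assume "nonprop u v"
  then show "fun_space.span {u} \<noteq> fun_space.span {v}"
    using fun_space.span_base[of u "{u}"] fun_space.span_singleton[of v] by (auto simp: not_nonprop_vscale)
next
  assume neq: "fun_space.span {u} \<noteq> fun_space.span {v}"
  show "nonprop u v"
  proof (rule ccontr)
    assume "\<not> nonprop u v"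
    then obtain c where c: "u = vscale c v" using assms by (auto elim: not_nonpropE)
    with assms have "c \<noteq> 0" by (auto simp: vscale_def zero_fun_def)
    with c have "v = vscale (1 / c) u" by (auto simp: vscale_def)
    with c have "u \<in> fun_space.span {v}" "v \<in> fun_space.span {u}"
      by (auto simp only: fun_space.span_singleton)
    then show False
      using neq fun_space.span_eq[of "{u}" "{v}"] by simp
  qed
qed

lemma span_vscale: "c \<noteq> 0 \<Longrightarrow> v \<noteq> 0 \<Longrightarrow> fun_space.span {vscale c v} = fun_space.span {v}"
  using nonprop_iff_span[of "vscale c v" v] not_nonprop_vscale
  by (auto simp: vscale_def fun_eq_iff)

text \<open>Cramer's rule: where the minor of \<open>X\<close> and \<open>Y\<close> is nonzero, the
  members at \<open>s\<close> and \<open>t\<close> can be solved for \<open>u\<close> and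
  \<open>v\<close>. This recovers the two vectors at one position from the fibres of a sum of two
  products.\<close>

lemma nonprop_mem:
  assumes W: "fun_space.subspace W" and n: "nonprop X Y"
    and m: "\<And>s. vscale (X s) u + vscale (Y s) v \<in> W"
  shows "u \<in> W" and "v \<in> W"
proof -
  have *: "u \<in> W" if n: "nonprop X Y" and m: "\<And>s. vscale (X s) u + vscale (Y s) v \<in> W" for X Y u v
  proof -
    from n obtain s t where D: "X s * Y t - X t * Y s \<noteq> 0" (is "?D \<noteq> 0") by (auto simp: nonprop_def)
    have "vscale (Y t) (vscale (X s) u + vscale (Y s) v)
        - vscale (Y s) (vscale (X t) u + vscale (Y t) v) \<in> W"
      using W m by (intro fun_space.subspace_diff fun_space.subspace_scale)
    also have "vscale (Y t) (vscale (X s) u + vscale (Y s) v)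
        - vscale (Y s) (vscale (X t) u + vscale (Y t) v) = vscale ?D u"
      by (simp add: vscale_def fun_eq_iff algebra_simps)
    finally have "vscale (1 / ?D) (vscale ?D u) \<in> W"
      by (rule fun_space.subspace_scale[OF W])
    moreover have "vscale (1 / ?D) (vscale ?D u) = u" using D by (auto simp: vscale_def fun_eq_iff)
    ultimately show "u \<in> W" by (simp only:)
  qed
  show "u \<in> W" using n m by (rule *)
  show "v \<in> W" using nonprop_sym[OF n] m by (intro *[of Y X v u]) (auto simp: add.commute)
qed

lemma nonprop_coeffs:
  assumes "nonprop x y" and "vscale a x + vscale b y = vscale c x + vscale d y"
  shows "a = c" and "b = d"
proof -
  from assms(1) obtain s t where D: "x s * y t - x t * y s \<noteq> 0" (is "?D \<noteq> 0")
    by (auto simp: nonprop_def)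
  have e: "a * x r + b * y r = c * x r + d * y r" for r
    using assms(2) by (auto simp: vscale_def fun_eq_iff)
  have "(a - c) * ?D = (a * x s + b * y s - (c * x s + d * y s)) * y t
      - (a * x t + b * y t - (c * x t + d * y t)) * y s" by (simp add: algebra_simps)
  then show "a = c" using D e[of s] e[of t] by simp
  have "(b - d) * ?D = (a * x t + b * y t - (c * x t + d * y t)) * x s
      - (a * x s + b * y s - (c * x s + d * y s)) * x t" by (simp add: algebra_simps)
  then show "b = d" using D e[of s] e[of t] by simp
qed

section \<open>Products of vectors over a finite set of positions\<close>

text \<open>Multi-indices are functions here, so that a position can be removed from
  \<open>J\<close> without renumbering the others; values of \<open>s\<close> outside
  \<open>J\<close> are not read.\<close>

definition tprod :: "'j set \<Rightarrow> ('j \<Rightarrow> 'i \<Rightarrow> 'a::field) \<Rightarrow> ('j \<Rightarrow> 'i) \<Rightarrow> 'a" where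
  "tprod J v s = (\<Prod>j\<in>J. v j (s j))"

lemma tprod_cong:
  "(\<And>j. j \<in> J \<Longrightarrow> v j = w j) \<Longrightarrow> (\<And>j. j \<in> J \<Longrightarrow> s j = t j) \<Longrightarrow> tprod J v s = tprod J w t"
  by (simp add: tprod_def)

lemma tprod_remove:
  "finite J \<Longrightarrow> i \<in> J \<Longrightarrow> tprod J v s = v i (s i) * tprod (J - {i}) v s"
  by (simp add: tprod_def prod.remove)

lemma tprod_upd_outside [simp]:
  "i \<notin> J \<Longrightarrow> tprod J v (s(i := a)) = tprod J v s"
  by (auto simp: tprod_def intro!: prod.cong)

lemma tprod_neq_0:
  assumes "finite J" "\<And>j. j \<in> J \<Longrightarrow> v j \<noteq> 0"
  shows "tprod J v \<noteq> 0"
proof -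
  have "\<exists>a. v j a \<noteq> 0" if "j \<in> J" for j using assms(2)[OF that] by (auto simp: fun_eq_iff)
  then obtain s where "\<And>j. j \<in> J \<Longrightarrow> v j (s j) \<noteq> 0" by metis
  then have "tprod J v s \<noteq> 0" using assms(1) by (simp add: tprod_def)
  then show ?thesis by (auto simp: fun_eq_iff)
qed

text \<open>Fix the other indices where the remaining factors of \<open>b\<close> have a nonzero
  product and let the index at \<open>i\<close> vary: \<open>b i\<close> becomes a multiple of
  \<open>d i\<close>.\<close>

lemma tprod_proportional_factors:
  assumes "finite J" and b: "\<And>j. j \<in> J \<Longrightarrow> b j \<noteq> 0"
    and eq: "tprod J b = vscale c (tprod J d)" and "i \<in> J"
  shows "\<not> nonprop (b i) (d i)"
proof -
  have "tprod (J - {i}) b \<noteq> 0" using assms by (intro tprod_neq_0) auto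
  then obtain s where s: "tprod (J - {i}) b s \<noteq> 0" by (auto simp: fun_eq_iff)
  have "b i a * tprod (J - {i}) b s = c * (d i a * tprod (J - {i}) d s)" for a
    using fun_cong[OF eq, of "s(i := a)"] \<open>finite J\<close> \<open>i \<in> J\<close> by (simp add: tprod_remove vscale_def)
  then have "b i = vscale (c * tprod (J - {i}) d s / tprod (J - {i}) b s) (d i)"
    using s by (simp add: vscale_def fun_eq_iff field_simps)
  then show ?thesis using not_nonprop_vscale by metis
qed

lemma nonprop_tprod:
  assumes "finite J" "\<And>j. j \<in> J \<Longrightarrow> b j \<noteq> 0" "\<And>j. j \<in> J \<Longrightarrow> d j \<noteq> 0"
    and "i \<in> J" "nonprop (b i) (d i)"
  shows "nonprop (tprod J b) (tprod J d)"
proof (rule ccontr)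
  assume "\<not> ?thesis"
  then obtain c where "tprod J b = vscale c (tprod J d)"
    using tprod_neq_0[of J d] assms by (auto elim: not_nonpropE)
  then show False using tprod_proportional_factors[of J b c d i] assms by blast
qed

lemma tprod_proportional:
  assumes "finite J" "\<And>j. j \<in> J \<Longrightarrow> b j \<noteq> 0" "\<And>j. j \<in> J \<Longrightarrow> d j \<noteq> 0"
    and "\<And>j. j \<in> J \<Longrightarrow> \<not> nonprop (b j) (d j)"
  obtains c where "c \<noteq> 0" "tprod J b = vscale c (tprod J d)"
proof -
  have "\<forall>j\<in>J. \<exists>c. b j = vscale c (d j)" using assms by (metis not_nonpropE)
  then obtain c where c: "\<And>j. j \<in> J \<Longrightarrow> b j = vscale (c j) (d j)" by metis
  have "tprod J b = vscale (\<Prod>j\<in>J. c j) (tprod J d)"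
    using c by (simp add: tprod_def vscale_def fun_eq_iff prod.distrib)
  moreover have "(\<Prod>j\<in>J. c j) \<noteq> 0"
    using c assms(1,2) by (metis fun_space.scale_zero_left prod_zero_iff)
  ultimately show thesis using that by blast
qed

text \<open>Every fibre of a product in direction \<open>j\<close> lies on the line of
  \<open>x j\<close>. If both coefficients were nonzero, position \<open>l\<close> would keep the
  products over \<open>K - {j}\<close> independent, so \<open>nonprop_mem\<close> would put the
  independent \<open>u j\<close> and \<open>v j\<close> on that one line.\<close>

lemma tprod_combination_coeff_0:
  assumes fin: "finite K" and u: "\<And>j. j \<in> K \<Longrightarrow> u j \<noteq> 0" and v: "\<And>j. j \<in> K \<Longrightarrow> v j \<noteq> 0"
    and jl: "j \<in> K" "l \<in> K" "j \<noteq> l" and nj: "nonprop (u j) (v j)" and nl: "nonprop (u l) (v l)"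
    and eq: "\<And>s. a * tprod K u s + b * tprod K v s = tprod K x s"
  shows "a = 0 \<or> b = 0"
proof (rule ccontr)
  assume "\<not> ?thesis"
  then have ab: "a \<noteq> 0" "b \<noteq> 0" by auto
  let ?L = "K - {j}"
  have "nonprop (tprod ?L u) (tprod ?L v)"
    using fin u v jl nl by (intro nonprop_tprod[of _ _ _ l]) auto
  then have n: "nonprop (vscale a (tprod ?L u)) (vscale b (tprod ?L v))"
    using ab by (rule nonprop_vscale)
  have "vscale (vscale a (tprod ?L u) s) (u j) + vscale (vscale b (tprod ?L v) s) (v j)
      \<in> fun_space.span {x j}" for s
  proof -
    have "a * (u j c * tprod ?L u s) + b * (v j c * tprod ?L v s) = x j c * tprod ?L x s" for c
      using eq[of "s(j := c)"] fin jl by (simp add: tprod_remove)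
    then have "vscale (vscale a (tprod ?L u) s) (u j) + vscale (vscale b (tprod ?L v) s) (v j)
        = vscale (tprod ?L x s) (x j)"
      by (simp add: vscale_def fun_eq_iff algebra_simps)
    then show ?thesis by (simp add: fun_space.span_base fun_space.span_scale)
  qed
  from nonprop_mem[OF fun_space.subspace_span n this]
  have "u j \<in> fun_space.span {x j}" "v j \<in> fun_space.span {x j}" by auto
  then obtain c d where "u j = vscale c (x j)" "v j = vscale d (x j)"
    by (auto simp: fun_space.span_singleton)
  then show False using nj by (simp add: nonprop_def vscale_def mult_ac)
qed

lemma mem_span_pair: "z \<in> fun_space.span {x, y} \<longleftrightarrow> (\<exists>a b. z = vscale a x + vscale b y)"
proof
  assume "z \<in> fun_space.span {x, y}"
  then obtain a where "z - vscale a x \<in> fun_space.span {y}"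
    using fun_space.span_breakdown_eq[of z x "{y}"] by auto
  then obtain b where "z - vscale a x = vscale b y"
    unfolding fun_space.span_singleton by auto
  then have "z = vscale a x + vscale b y" by (simp add: algebra_simps)
  then show "\<exists>a b. z = vscale a x + vscale b y" by blast
next
  assume "\<exists>a b. z = vscale a x + vscale b y"
  then obtain a b where "z = vscale a x + vscale b y" by blast
  then show "z \<in> fun_space.span {x, y}"
    by (simp add: fun_space.span_add fun_space.span_scale fun_space.span_base)
qed

text \<open>Position \<open>i\<close> serves for the expansion, while \<open>j\<close> and
  \<open>l\<close> remain in \<open>J - {i}\<close> and make
  \<open>tprod_combination_coeff_0\<close> applicable there.\<close>

lemma tprod_sum_unique:
  assumes fin: "finite J" and u: "\<And>j. j \<in> J \<Longrightarrow> u j \<noteq> 0" and v: "\<And>j. j \<in> J \<Longrightarrow> v j \<noteq> 0"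
    and ijl: "i \<in> J" "j \<in> J" "l \<in> J" "i \<noteq> j" "i \<noteq> l" "j \<noteq> l"
    and n: "nonprop (u i) (v i)" "nonprop (u j) (v j)" "nonprop (u l) (v l)"
    and eq: "\<And>s. tprod J u s + tprod J v s = tprod J x s + tprod J y s"
  shows "tprod J u = tprod J x \<and> tprod J v = tprod J y \<or> tprod J u = tprod J y \<and> tprod J v = tprod J x"
proof -
  let ?K = "J - {i}"
  let ?U = "tprod ?K u" and ?V = "tprod ?K v" and ?X = "tprod ?K x" and ?Y = "tprod ?K y"
  have fib: "vscale (?U s) (u i) + vscale (?V s) (v i) = vscale (?X s) (x i) + vscale (?Y s) (y i)" for s
  proof
    fix c
    show "(vscale (?U s) (u i) + vscale (?V s) (v i)) c = (vscale (?X s) (x i) + vscale (?Y s) (y i)) c"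
      using eq[of "s(i := c)"] fin ijl by (simp add: tprod_remove vscale_def algebra_simps)
  qed
  have "nonprop ?U ?V" using fin u v ijl n by (intro nonprop_tprod[of _ _ _ j]) auto
  note nonprop_mem[OF fun_space.subspace_span this, of "u i" "v i" "{x i, y i}"]
  with fib have "u i \<in> fun_space.span {x i, y i}" "v i \<in> fun_space.span {x i, y i}"
    by (auto simp: mem_span_pair)
  then obtain a b c d where ui: "u i = vscale a (x i) + vscale b (y i)"
    and vi: "v i = vscale c (x i) + vscale d (y i)"
    by (auto simp: mem_span_pair)
  \<comment> \<open>The minor of \<open>u i\<close> and \<open>v i\<close> is the determinant of the
    change of coordinates times the minor of \<open>x i\<close> and \<open>y i\<close>. As it is
    nonzero somewhere, so are both factors.\<close>
  have det: "u i s * v i t - u i t * v i s = (a * d - b * c) * (x i s * y i t - x i t * y i s)" for s t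
    by (simp add: ui vi vscale_def algebra_simps)
  obtain s t where "u i s * v i t - u i t * v i s \<noteq> 0" using n(1) by (auto simp: nonprop_def)
  then have nxy: "nonprop (x i) (y i)" and D: "a * d - b * c \<noteq> 0"
    unfolding det by (auto simp: nonprop_def)
  have XY: "vscale (?X s) (x i) + vscale (?Y s) (y i) =
      vscale (a * ?U s + c * ?V s) (x i) + vscale (b * ?U s + d * ?V s) (y i)" for s
    unfolding fib[symmetric] ui vi by (simp add: vscale_def fun_eq_iff algebra_simps)
  have X: "a * ?U s + c * ?V s = ?X s" and Y: "b * ?U s + d * ?V s = ?Y s" for s
    using nonprop_coeffs[OF nxy XY[of s]] by auto
  have ac: "a = 0 \<or> c = 0"
    using fin u v ijl n X by (intro tprod_combination_coeff_0[of ?K u v j l a c x]) auto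
  have bd: "b = 0 \<or> d = 0"
    using fin u v ijl n Y by (intro tprod_combination_coeff_0[of ?K u v j l b d y]) auto
  \<comment> \<open>The determinant \<open>D\<close> excludes \<open>a = b = 0\<close> and
    \<open>c = d = 0\<close>. The two remaining cases match \<open>u i\<close> with
    \<open>y i\<close> or with \<open>x i\<close>.\<close>
  consider "a = 0" "d = 0" | "b = 0" "c = 0"
    using ac bd D by auto
  then show ?thesis
  proof cases
    case 1
    have "tprod J u s = tprod J y s \<and> tprod J v s = tprod J x s" for s
      using fin ijl X[of s] Y[of s] 1 ui vi by (simp add: tprod_remove vscale_def)
    then show ?thesis by auto
  next
    case 2
    have "tprod J u s = tprod J x s \<and> tprod J v s = tprod J y s" for s
      using fin ijl X[of s] Y[of s] 2 ui vi by (simp add: tprod_remove vscale_def)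
    then show ?thesis by auto
  qed
qed

section \<open>Points of the Segre variety and decompositions into two of them\<close>

abbreviation pt :: "('i \<Rightarrow> 'a::field) \<Rightarrow> ('i, 'a) point" where
  "pt v \<equiv> fun_space.span {v}"

lemma pt_eq_pt_iff: "u \<noteq> 0 \<Longrightarrow> v \<noteq> 0 \<Longrightarrow> pt u = pt v \<longleftrightarrow> \<not> nonprop u v"
  by (simp add: nonprop_iff_span)

lemma pt_mem_proj_of_iff:
  assumes "fun_space.subspace W"
  shows "pt w \<in> proj_of W \<longleftrightarrow> w \<in> W \<and> w \<noteq> 0"
proof
  assume "pt w \<in> proj_of W"
  then obtain v where v: "pt w = pt v" "v \<in> W" "v \<noteq> 0" by (auto simp: proj_of_def)
  then have "w \<in> pt v" "v \<in> pt w" using fun_space.span_base[of w "{w}"] fun_space.span_base[of v "{v}"] by auto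
  moreover have "pt v \<subseteq> W" using v assms by (simp add: fun_space.span_minimal)
  ultimately show "w \<in> W \<and> w \<noteq> 0" using v by auto
qed (auto simp: proj_of_def)

lemma pt_mem_proj_span_iff: "pt w \<in> proj_span S \<longleftrightarrow> w \<in> fun_space.span (\<Union>S) \<and> w \<noteq> 0"
  by (simp add: proj_span_def pt_mem_proj_of_iff)

lemma span_Union_pt: "fun_space.span (\<Union>(pt ` F)) = fun_space.span F"
proof (rule fun_space.span_eq[THEN iffD2], intro conjI)
  show "\<Union>(pt ` F) \<subseteq> fun_space.span F"
    using fun_space.span_mono[of "{v}" F for v] by blast
  show "F \<subseteq> fun_space.span (\<Union>(pt ` F))"
  proof
    fix v assume "v \<in> F"
    moreover have "v \<in> pt v" by (rule fun_space.span_base) simp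
    ultimately have "v \<in> \<Union>(pt ` F)" by blast
    then show "v \<in> fun_space.span (\<Union>(pt ` F))" by (rule fun_space.span_base)
  qed
qed

lemma pt_mem_proj_span_pt_iff: "pt w \<in> proj_span (pt ` F) \<longleftrightarrow> w \<in> fun_space.span F \<and> w \<noteq> 0"
  unfolding pt_mem_proj_span_iff span_Union_pt ..

lemma subspace_coord_space: "fun_space.subspace (coord_space I)"
  by (rule fun_space.subspaceI) (auto simp: coord_space_def vscale_def)

section \<open>Coordinates of tensors and representatives of points\<close>

lemma tensor_eq_tprod:
  "length as = length vs \<Longrightarrow> tensor vs as = tprod {..<length vs} ((!) vs) ((!) as)"
  by (simp add: tensor_def tprod_def)

lemma tprod_eq_tensor:
  "tprod {..<length vs} ((!) vs) s = tensor vs (map s [0..<length vs])"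
  by (simp add: tensor_def tprod_def)

lemma tensor_eq_0: "length as \<noteq> length vs \<Longrightarrow> tensor vs as = 0"
  by (simp add: tensor_def)

lemma tprod_list_update:
  assumes "i < length vs"
  shows "tprod {..<length vs} ((!) (vs[i := x])) s = x (s i) * tprod ({..<length vs} - {i}) ((!) vs) s"
proof -
  have "tprod ({..<length vs} - {i}) ((!) (vs[i := x])) s = tprod ({..<length vs} - {i}) ((!) vs) s"
    by (rule tprod_cong) auto
  then show ?thesis using assms by (simp add: tprod_remove[of _ i])
qed

lemma tprod_nth_list_update:
  "i < length as \<Longrightarrow> tprod ({..<length as} - {i}) v ((!) (as[i := a])) = tprod ({..<length as} - {i}) v ((!) as)"
  by (rule tprod_cong) auto

lemma tensor_list_update:
  assumes "length as = length vs" "i < length vs"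
  shows "tensor vs (as[i := a]) = (vs ! i) a * tprod ({..<length vs} - {i}) ((!) vs) ((!) as)"
  using assms tprod_nth_list_update[of i as "(!) vs" a]
  by (simp add: tensor_eq_tprod tprod_remove[of _ i])

lemma tensor_neq_0:
  assumes "\<And>i. i < length vs \<Longrightarrow> vs ! i \<noteq> 0"
  shows "tensor vs \<noteq> 0"
proof
  assume "tensor vs = 0"
  then have "tprod {..<length vs} ((!) vs) s = 0" for s by (simp add: tprod_eq_tensor)
  then have "tprod {..<length vs} ((!) vs) = 0" by (auto simp: fun_eq_iff)
  then show False using tprod_neq_0[of "{..<length vs}" "(!) vs"] assms by auto
qed

definition representatives :: "nat list \<Rightarrow> (nat \<Rightarrow> 'a::field) list \<Rightarrow> bool" where
  "representatives ns vs \<longleftrightarrow> length vs = length ns \<and>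
     (\<forall>i<length ns. vs ! i \<in> coord_space {..ns ! i} \<and> vs ! i \<noteq> 0)"

lemma representatives_list_update:
  "representatives ns vs \<Longrightarrow> i < length ns \<Longrightarrow> x \<in> coord_space {..ns ! i} \<Longrightarrow> x \<noteq> 0 \<Longrightarrow>
   representatives ns (vs[i := x])"
  by (auto simp: representatives_def nth_list_update)

lemma multiproj_space_eq: "multiproj_space ns = map pt ` {vs. representatives ns vs}"
proof (intro equalityI subsetI)
  fix ys :: "(nat, 'a::field) point list"
  assume "ys \<in> multiproj_space ns"
  then have ys: "length ys = length ns" "\<And>i. i < length ns \<Longrightarrow> ys ! i \<in> proj_space (ns ! i)"
    by (auto simp: multiproj_space_def mem_listset_iff list_all2_conv_all_nth)
  then have "\<forall>i<length ns. \<exists>v. ys ! i = pt v \<and> v \<in> coord_space {..ns ! i} \<and> v \<noteq> 0"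
    by (fastforce simp: proj_space_def proj_of_def)
  then obtain v where v: "\<And>i. i < length ns \<Longrightarrow>
      ys ! i = pt (v i) \<and> v i \<in> coord_space {..ns ! i} \<and> v i \<noteq> 0"
    by metis
  have "ys = map pt (map v [0..<length ns])" using ys(1) v by (intro nth_equalityI) auto
  moreover have "representatives ns (map v [0..<length ns])" using v by (auto simp: representatives_def)
  ultimately show "ys \<in> map pt ` {vs. representatives ns vs}" by blast
next
  fix ys :: "(nat, 'a::field) point list"
  assume "ys \<in> map pt ` {vs. representatives ns vs}"
  then show "ys \<in> multiproj_space ns"
    by (auto simp: multiproj_space_def mem_listset_iff list_all2_conv_all_nth representatives_def
        proj_space_def pt_mem_proj_of_iff subspace_coord_space)
qed

text \<open>Injectivity of the Segre embedding: the factors of equal nonzero products are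
  proportional position by position.\<close>

lemma tensor_eq_imp_pt_eq:
  assumes "representatives ns us" "representatives ns vs"
    and "tprod {..<length ns} ((!) us) = tprod {..<length ns} ((!) vs)"
  shows "map pt us = map pt vs"
proof -
  have "\<not> nonprop (us ! i) (vs ! i)" if "i < length ns" for i
    using assms that tprod_proportional_factors[of "{..<length ns}" "(!) us" 1 "(!) vs" i]
    by (auto simp: representatives_def)
  then show ?thesis
    using assms(1,2) by (intro nth_equalityI) (auto simp: representatives_def pt_eq_pt_iff)
qed

text \<open>Serves for contradictions: a vector of rank 2 is never a single product.\<close>

lemma xrank_tensor_le:
  assumes "representatives ns vs"
  shows "xrank (segre ` multiproj_space ns) (pt (tensor vs)) \<le> 1"
  unfolding xrank_def
proof (rule Least_le)
  have "tensor vs \<noteq> 0" using assms by (intro tensor_neq_0) (auto simp: representatives_def)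
  moreover have "segre (map pt vs) \<in> segre ` multiproj_space ns"
    using assms by (auto simp: multiproj_space_eq)
  ultimately show "\<exists>S. finite S \<and> S \<subseteq> segre ` multiproj_space ns \<and> card S = 1 \<and> pt (tensor vs) \<in> proj_span S"
    by (intro exI[of _ "{pt (tensor vs)}"])
      (auto simp: segre_representatives pt_mem_proj_span_iff fun_space.span_base)
qed

lemma finite_listset: "(\<And>A. A \<in> set As \<Longrightarrow> finite A) \<Longrightarrow> finite (listset As)"
proof (induction As)
  case (Cons A As)
  have "listset (A # As) = (\<lambda>(x, xs). x # xs) ` (A \<times> listset As)"
    by (auto simp: set_Cons_def)
  with Cons show ?case by simp
qed simp

lemma sum_fun_apply: "(\<Sum>i\<in>I. f i) x = (\<Sum>i\<in>I. f i x)"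
  by (induction I rule: infinite_finite_induct) auto

lemma tensor_unit_vectors:
  "tensor (map (\<lambda>a b. if b = a then 1 else 0) as) bs = (if bs = as then 1 else 0 :: 'a::field)"
  by (auto simp: tensor_def list_eq_iff_nth_eq)

text \<open>\<open>xrank\<close> is a \<open>LEAST\<close>, whose value is attained only if some
  finite set qualifies. The products of unit vectors, one for each multi-index, form such a
  set.\<close>

lemma mem_proj_span_finite:
  fixes w :: "nat list \<Rightarrow> 'a::field"
  assumes w: "w \<in> coord_space (listset (map (\<lambda>n. {..n}) ns))" "w \<noteq> 0"
  obtains S where "finite S" "S \<subseteq> segre ` multiproj_space ns" "pt w \<in> proj_span S"
proof -
  let ?I = "listset (map (\<lambda>n. {..n}) ns)"
  let ?u = "\<lambda>as. map (\<lambda>a b. if b = a then 1 else 0 :: 'a) as"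
  have fin: "finite ?I" by (intro finite_listset) auto
  have "w = (\<Sum>as\<in>?I. vscale (w as) (tensor (?u as)))"
  proof
    fix bs
    have "(\<Sum>as\<in>?I. vscale (w as) (tensor (?u as))) bs = (\<Sum>as\<in>?I. if as = bs then w as else 0)"
      unfolding sum_fun_apply by (intro sum.cong) (auto simp: vscale_def tensor_unit_vectors)
    also have "\<dots> = w bs" using w fin by (auto simp: coord_space_def)
    finally show "w bs = (\<Sum>as\<in>?I. vscale (w as) (tensor (?u as))) bs" by simp
  qed
  also have "\<dots> \<in> fun_space.span ((tensor \<circ> ?u) ` ?I)"
    by (intro fun_space.span_sum fun_space.span_scale fun_space.span_base) auto
  finally have "pt w \<in> proj_span (pt ` (tensor \<circ> ?u) ` ?I)"
    using w unfolding pt_mem_proj_span_pt_iff by blast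
  moreover have "pt ` (tensor \<circ> ?u) ` ?I \<subseteq> segre ` multiproj_space ns"
  proof safe
    fix as assume "as \<in> ?I"
    then have "representatives ns (?u as)"
      by (auto simp: representatives_def mem_listset_iff list_all2_conv_all_nth coord_space_def fun_eq_iff)
    then show "pt ((tensor \<circ> ?u) as) \<in> segre ` multiproj_space ns"
      by (auto simp: multiproj_space_eq segre_representatives image_iff intro!: bexI[of _ "?u as"])
  qed
  ultimately show thesis using fin by (intro that) auto
qed

text \<open>The scalar is absorbed by the first factor. For \<open>ns = []\<close> there is none,
  and the tensor of the empty list cannot be rescaled.\<close>

lemma tensor_scale:
  assumes "representatives ns vs" "c \<noteq> 0" "ns \<noteq> []"
  obtains ws where "representatives ns ws" "map pt ws = map pt vs" "tensor ws = vscale c (tensor vs)"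
proof (rule that)
  let ?ws = "vs[0 := vscale c (vs ! 0)]"
  have 0: "vs ! 0 \<noteq> 0" "0 < length vs" "length vs = length ns" using assms by (auto simp: representatives_def)
  have "vscale c (vs ! 0) \<noteq> 0" using 0 assms by (simp add: fun_space.scale_eq_0_iff)
  then show "representatives ns ?ws"
    using assms 0 by (intro representatives_list_update)
      (auto simp: representatives_def fun_space.subspace_scale subspace_coord_space)
  show "map pt ?ws = map pt vs"
    using 0 assms by (intro nth_equalityI) (auto simp: span_vscale nth_list_update)
  show "tensor ?ws = vscale c (tensor vs)"
  proof
    fix as
    show "tensor ?ws as = vscale c (tensor vs) as"
      using tprod_list_update[OF 0(2), of "vscale c (vs ! 0)" "(!) as"]
        tprod_remove[of "{..<length vs}" 0 "(!) vs" "(!) as"] 0(2)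
      by (cases "length as = length vs") (simp_all add: tensor_eq_tprod tensor_eq_0 vscale_def)
  qed
qed

section \<open>Decompositions into two products\<close>

text \<open>Both coefficients can be taken to be 1, since \<open>tensor_scale\<close> absorbs
  scalars. The points are distinct so that they form a set of cardinality 2.\<close>

definition decomposition where
  "decomposition ns w us vs \<longleftrightarrow> representatives ns us \<and> representatives ns vs \<and>
     map pt us \<noteq> map pt vs \<and> w = tensor us + tensor vs"

lemma decomposition_tprod:
  assumes "decomposition ns w us vs"
  shows "w (map s [0..<length ns]) = tprod {..<length ns} ((!) us) s + tprod {..<length ns} ((!) vs) s"
proof -
  have "length us = length ns" "length vs = length ns" "w = tensor us + tensor vs"
    using assms by (auto simp: decomposition_def representatives_def)
  then show ?thesis using tprod_eq_tensor[of us s] tprod_eq_tensor[of vs s] by simp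
qed

lemma mem_evincing_sets_iff:
  assumes "w \<noteq> 0" and rank: "xrank (segre ` multiproj_space ns) (pt w) = 2"
  shows "A \<in> evincing_sets ns (pt w) \<longleftrightarrow>
    (\<exists>us vs. decomposition ns w us vs \<and> A = {map pt us, map pt vs})"
proof
  assume "A \<in> evincing_sets ns (pt w)"
  then have A: "A \<subseteq> multiproj_space ns" "card A = 2" "pt w \<in> proj_span (segre ` A)"
    using rank by (auto simp: evincing_sets_def)
  then obtain us vs where us: "representatives ns us" and vs: "representatives ns vs"
    and Auv: "A = {map pt us, map pt vs}" "map pt us \<noteq> map pt vs"
    by (auto simp: card_2_iff multiproj_space_eq)
  have "segre ` A = pt ` {tensor us, tensor vs}" using Auv by (auto simp: segre_representatives)
  with A(3) have "w \<in> fun_space.span {tensor us, tensor vs}"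
    using pt_mem_proj_span_pt_iff[of w "{tensor us, tensor vs}"] by (simp only:)
  then obtain a b where w: "w = vscale a (tensor us) + vscale b (tensor vs)"
    unfolding mem_span_pair by blast
  \<comment> \<open>If \<open>a\<close> or \<open>b\<close> were 0, then \<open>w\<close> would be a
    multiple of one product and have rank at most 1.\<close>
  have not1: "w \<noteq> vscale c (tensor xs)" if "representatives ns xs" for c xs
  proof
    assume e: "w = vscale c (tensor xs)"
    then have "c \<noteq> 0" "tensor xs \<noteq> 0" using \<open>w \<noteq> 0\<close> by auto
    then have "pt w = pt (tensor xs)" using e by (simp add: span_vscale)
    then show False using rank xrank_tensor_le[OF that] by simp
  qed
  have ab: "a \<noteq> 0" "b \<noteq> 0" using w not1[OF us, of a] not1[OF vs, of b] by auto
  \<comment> \<open>With no factors there is only one point, whereas \<open>A\<close> has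
    two.\<close>
  have "ns \<noteq> []" using Auv us vs by (auto simp: representatives_def)
  obtain us' where "representatives ns us'" "map pt us' = map pt us" "tensor us' = vscale a (tensor us)"
    by (rule tensor_scale[OF us ab(1) \<open>ns \<noteq> []\<close>])
  moreover obtain vs' where "representatives ns vs'" "map pt vs' = map pt vs" "tensor vs' = vscale b (tensor vs)"
    by (rule tensor_scale[OF vs ab(2) \<open>ns \<noteq> []\<close>])
  ultimately show "\<exists>us vs. decomposition ns w us vs \<and> A = {map pt us, map pt vs}"
    using w Auv by (intro exI[of _ us'] exI[of _ vs']) (auto simp: decomposition_def)
next
  assume "\<exists>us vs. decomposition ns w us vs \<and> A = {map pt us, map pt vs}"
  then obtain us vs where d: "decomposition ns w us vs" and A: "A = {map pt us, map pt vs}" by blast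
  have "segre ` A = pt ` {tensor us, tensor vs}" using A by (auto simp: segre_representatives)
  moreover have "w \<in> fun_space.span {tensor us, tensor vs}"
    using d by (simp add: decomposition_def fun_space.span_add fun_space.span_base)
  ultimately have "pt w \<in> proj_span (segre ` A)"
    using \<open>w \<noteq> 0\<close> pt_mem_proj_span_pt_iff[of w "{tensor us, tensor vs}"] by (simp only: not_False_eq_True simp_thms)
  then show "A \<in> evincing_sets ns (pt w)"
    using d A rank by (auto simp: evincing_sets_def decomposition_def multiproj_space_eq)
qed

lemma decomposition_exists:
  assumes w: "w \<in> coord_space (listset (map (\<lambda>n. {..n}) ns))" "w \<noteq> 0"
    and rank: "xrank (segre ` multiproj_space ns) (pt w) = 2"
  obtains us vs where "decomposition ns w us vs"
proof -
  let ?P = "\<lambda>r. \<exists>S. finite S \<and> S \<subseteq> segre ` multiproj_space ns \<and> card S = r \<and> pt w \<in> proj_span S"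
  obtain S where "finite S" "S \<subseteq> segre ` multiproj_space ns" "pt w \<in> proj_span S"
    using mem_proj_span_finite[OF w] .
  then have "?P (card S)" by blast
  then have "?P (LEAST r. ?P r)" by (rule LeastI)
  then have "?P 2" using rank unfolding xrank_def by (simp only:)
  then obtain S where S: "S \<subseteq> segre ` multiproj_space ns" "card S = 2" "pt w \<in> proj_span S" by blast
  \<comment> \<open>Choosing one preimage for each point of \<open>S\<close> keeps the cardinality
    2.\<close>
  then obtain A where "A \<subseteq> multiproj_space ns" "S = segre ` A" "inj_on segre A"
    by (auto simp: subset_image_inj)
  with S have A: "A \<subseteq> multiproj_space ns" "card A = 2" "pt w \<in> proj_span (segre ` A)"
    by (auto simp: card_image)
  then have "A \<in> evincing_sets ns (pt w)"
    using rank by (auto simp: evincing_sets_def card_2_iff)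
  then show thesis using mem_evincing_sets_iff[OF w(2) rank] that by blast
qed

section \<open>Positions with independent vectors, and fibres of the tensor\<close>

definition nonprop_positions :: "(nat \<Rightarrow> 'a::field) list \<Rightarrow> (nat \<Rightarrow> 'a) list \<Rightarrow> nat set" where
  "nonprop_positions us vs = {i. i < length us \<and> nonprop (us ! i) (vs ! i)}"

lemma finite_nonprop_positions: "finite (nonprop_positions us vs)"
  by (simp add: nonprop_positions_def)

text \<open>If all positions other than \<open>i\<close> were proportional, the two products over
  them would differ by a scalar \<open>c\<close>. Then \<open>w\<close> would be the single product
  with \<open>us ! i + vscale c (vs ! i)\<close> at position \<open>i\<close>, which has rank at
  most 1.\<close>

lemma decomposition_other_nonprop:
  assumes "w \<noteq> 0" and rank: "xrank (segre ` multiproj_space ns) (pt w) = 2"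
    and d: "decomposition ns w us vs" and i: "i < length ns"
  shows "\<exists>j<length ns. j \<noteq> i \<and> nonprop (us ! j) (vs ! j)"
proof (rule ccontr)
  assume "\<not> ?thesis"
  then have np: "\<not> nonprop (vs ! j) (us ! j)" if "j < length ns" "j \<noteq> i" for j
    using that nonprop_sym[of "vs ! j" "us ! j"] by blast
  have us: "representatives ns us" and vs: "representatives ns vs" and w: "w = tensor us + tensor vs"
    using d by (auto simp: decomposition_def)
  have len: "length us = length ns" "length vs = length ns" using us vs by (auto simp: representatives_def)
  obtain c where c: "tprod ({..<length ns} - {i}) ((!) vs) = vscale c (tprod ({..<length ns} - {i}) ((!) us))"
    by (rule tprod_proportional[of "{..<length ns} - {i}" "(!) vs" "(!) us"])
      (use us vs np in \<open>auto simp: representatives_def\<close>)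
  let ?x = "us ! i + vscale c (vs ! i)"
  have T: "w = tensor (us[i := ?x])"
  proof
    fix as
    show "w as = tensor (us[i := ?x]) as"
      using len i tprod_list_update[of i us ?x "(!) as"]
        tprod_remove[of "{..<length ns}" i "(!) us" "(!) as"]
        tprod_remove[of "{..<length ns}" i "(!) vs" "(!) as"] c
      by (cases "length as = length ns") (auto simp: w tensor_eq_tprod tensor_eq_0 vscale_def algebra_simps)
  qed
  have "?x \<noteq> 0"
  proof
    assume "?x = 0"
    then have "tensor (us[i := ?x]) as = 0" for as
      using len i tprod_list_update[of i us ?x "(!) as"]
      by (cases "length as = length ns") (auto simp: tensor_eq_tprod tensor_eq_0)
    then show False using T \<open>w \<noteq> 0\<close> by (auto simp: fun_eq_iff)
  qed
  moreover have "?x \<in> coord_space {..ns ! i}"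
    using us vs i subspace_coord_space by (auto simp: representatives_def intro!: fun_space.subspace_add fun_space.subspace_scale)
  ultimately have "representatives ns (us[i := ?x])" using us i by (intro representatives_list_update)
  from xrank_tensor_le[OF this] show False using rank T by simp
qed

lemma card_nonprop_positions_ge_2:
  assumes "w \<noteq> 0" "xrank (segre ` multiproj_space ns) (pt w) = 2" and d: "decomposition ns w us vs"
  shows "card (nonprop_positions us vs) \<ge> 2"
proof -
  have len: "length us = length ns" "length vs = length ns" using d by (auto simp: decomposition_def representatives_def)
  have "0 < length ns" using d len by (auto simp: decomposition_def)
  \<comment> \<open>Excluding the arbitrary position 0 yields \<open>i\<close>; excluding
    \<open>i\<close> yields a second position \<open>j\<close>.\<close>
  from decomposition_other_nonprop[OF assms this] obtain i where i: "i < length ns" "nonprop (us ! i) (vs ! i)" by blast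
  from decomposition_other_nonprop[OF assms i(1)] obtain j where "j < length ns" "j \<noteq> i" "nonprop (us ! j) (vs ! j)" by blast
  then have "{i, j} \<subseteq> nonprop_positions us vs" "card {i, j} = 2" using i len by (auto simp: nonprop_positions_def)
  then show ?thesis using card_mono[OF finite_nonprop_positions] by metis
qed

text \<open>The tensors whose fibre through \<open>as\<close> in direction \<open>i\<close> lies in
  \<open>W\<close> form a subspace. It contains the tensor of every point of the product, because
  such a fibre is a multiple of the vector at position \<open>i\<close>.\<close>

lemma fibre_mem:
  assumes f: "f \<in> fun_space.span (\<Union>(segre ` listset Ms))"
    and i: "i < length Ms" "Ms ! i = proj_of W" and W: "fun_space.subspace W"
    and as: "length as = length Ms"
  shows "(\<lambda>a. f (as[i := a])) \<in> W"
proof -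
  let ?V = "{f. (\<lambda>a. f (as[i := a])) \<in> W}"
  have V: "fun_space.subspace ?V"
  proof (rule fun_space.subspaceI)
    show "0 \<in> ?V" using fun_space.subspace_0[OF W] by (simp add: zero_fun_def)
    show "f + g \<in> ?V" if "f \<in> ?V" "g \<in> ?V" for f g
      using fun_space.subspace_add[OF W, of "\<lambda>a. f (as[i := a])" "\<lambda>a. g (as[i := a])"] that
      by (simp add: plus_fun_def)
    show "vscale c f \<in> ?V" if "f \<in> ?V" for c f
      using fun_space.subspace_scale[OF W, of "\<lambda>a. f (as[i := a])" c] that
      by (simp add: vscale_def)
  qed
  have "segre p \<subseteq> ?V" if p: "p \<in> listset Ms" for p
    unfolding segre_def
  proof (rule fun_space.span_minimal[OF _ V], rule image_subsetI)
    fix ts assume ts: "ts \<in> listset p"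
    have len: "length ts = length Ms" "length p = length Ms"
      using ts p by (auto simp: mem_listset_iff list_all2_conv_all_nth)
    have "ts ! i \<in> p ! i" "p ! i \<in> proj_of W"
      using ts p i by (auto simp: mem_listset_iff list_all2_conv_all_nth)
    then obtain v where "ts ! i \<in> pt v" "v \<in> W" by (auto simp: proj_of_def)
    then have "ts ! i \<in> W" using W fun_space.span_minimal[of "{v}" W] by auto
    then have "vscale (tprod ({..<length ts} - {i}) ((!) ts) ((!) as)) (ts ! i) \<in> W"
      by (rule fun_space.subspace_scale[OF W])
    also have "vscale (tprod ({..<length ts} - {i}) ((!) ts) ((!) as)) (ts ! i) = (\<lambda>a. tensor ts (as[i := a]))"
      using len i as by (simp add: fun_eq_iff vscale_def tensor_list_update)
    finally show "tensor ts \<in> ?V" by simp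
  qed
  then have "fun_space.span (\<Union>(segre ` listset Ms)) \<subseteq> ?V"
    by (intro fun_space.span_minimal[OF _ V]) blast
  then show ?thesis using f by blast
qed

text \<open>By \<open>fibre_mem\<close>, the fibres of \<open>w\<close> in direction
  \<open>i\<close> lie in \<open>W\<close>. They are combinations of \<open>us ! i\<close> and
  \<open>vs ! i\<close> whose coefficients, the products over the other positions, are independent
  thanks to \<open>decomposition_other_nonprop\<close>; \<open>nonprop_mem\<close>
  concludes.\<close>

lemma decomposition_mem_factor:
  assumes "w \<noteq> 0" and rank: "xrank (segre ` multiproj_space ns) (pt w) = 2"
    and d: "decomposition ns w us vs"
    and Ms: "pt w \<in> proj_span (segre ` listset Ms)" "length Ms = length ns"
    and i: "i < length ns" "Ms ! i = proj_of W" and W: "fun_space.subspace W"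
  shows "us ! i \<in> W" and "vs ! i \<in> W"
proof -
  have us: "representatives ns us" and vs: "representatives ns vs" and w: "w = tensor us + tensor vs"
    using d by (auto simp: decomposition_def)
  have len: "length us = length ns" "length vs = length ns" using us vs by (auto simp: representatives_def)
  let ?K = "{..<length ns} - {i}"
  obtain j where "j < length ns" "j \<noteq> i" "nonprop (us ! j) (vs ! j)"
    using decomposition_other_nonprop[OF assms(1) rank d i(1)] by blast
  then have n: "nonprop (tprod ?K ((!) us)) (tprod ?K ((!) vs))"
    using us vs by (intro nonprop_tprod[of _ _ _ j]) (auto simp: representatives_def)
  have m: "vscale (tprod ?K ((!) us) s) (us ! i) + vscale (tprod ?K ((!) vs) s) (vs ! i) \<in> W" for s
  proof -
    let ?as = "map s [0..<length ns]"
    have c: "tprod ?K v ((!) ?as) = tprod ?K v s" for v :: "nat \<Rightarrow> nat \<Rightarrow> 'a"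
      by (rule tprod_cong) auto
    have "w \<in> fun_space.span (\<Union>(segre ` listset Ms))" using Ms(1) by (simp only: pt_mem_proj_span_iff)
    then have "(\<lambda>a. w (?as[i := a])) \<in> W" using Ms i W by (intro fibre_mem) auto
    also have "(\<lambda>a. w (?as[i := a])) =
        vscale (tprod ?K ((!) us) s) (us ! i) + vscale (tprod ?K ((!) vs) s) (vs ! i)"
      using len i tensor_list_update[of ?as us i] tensor_list_update[of ?as vs i]
      by (simp add: w fun_eq_iff vscale_def c)
    finally show ?thesis .
  qed
  show "us ! i \<in> W" "vs ! i \<in> W" using nonprop_mem[OF W n m] by auto
qed

section \<open>The concise Segre\<close>

definition factor_spans :: "(nat \<Rightarrow> 'a::field) list \<Rightarrow> (nat \<Rightarrow> 'a) list \<Rightarrow> (nat, 'a) point set list" where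
  "factor_spans us vs = map2 (\<lambda>u v. proj_of (fun_space.span {u, v})) us vs"

lemma length_factor_spans [simp]:
  "length us = length vs \<Longrightarrow> length (factor_spans us vs) = length vs"
  by (simp add: factor_spans_def)

lemma nth_factor_spans [simp]:
  "i < length us \<Longrightarrow> length us = length vs \<Longrightarrow>
   factor_spans us vs ! i = proj_of (fun_space.span {us ! i, vs ! i})"
  by (simp add: factor_spans_def)

lemma proj_of_mono: "V \<subseteq> W \<Longrightarrow> proj_of V \<subseteq> proj_of W"
  by (auto simp: proj_of_def)

lemma listset_mono: "list_all2 (\<subseteq>) As Bs \<Longrightarrow> listset As \<subseteq> listset Bs"
  by (auto simp: mem_listset_iff list_all2_conv_all_nth subset_iff)

text \<open>Any point of the factor can be put into the member \<open>x\<close> at position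
  \<open>i\<close>. The member matters: one empty factor makes the whole product empty.\<close>

lemma listset_subset_nth:
  assumes sub: "listset As \<subseteq> listset Bs" and x: "x \<in> listset As" and i: "i < length As"
  shows "As ! i \<subseteq> Bs ! i"
proof
  fix p assume "p \<in> As ! i"
  then have "x[i := p] \<in> listset As"
    using x i by (auto simp: mem_listset_iff list_all2_conv_all_nth nth_list_update)
  then have "x[i := p] \<in> listset Bs" using sub by blast
  then show "p \<in> Bs ! i"
    using i x by (auto simp: mem_listset_iff list_all2_conv_all_nth dest!: spec[of _ i])
qed

lemma representatives_mem_factor_spans:
  assumes us: "representatives ns us" and vs: "representatives ns vs"
  shows "map pt us \<in> listset (factor_spans us vs)" and "map pt vs \<in> listset (factor_spans us vs)"
  using assms
  by (auto simp: mem_listset_iff list_all2_conv_all_nth representatives_def pt_mem_proj_of_iff fun_space.span_base)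

text \<open>The equivalence gives existence and uniqueness at once, as the \<open>THE\<close> in
  \<open>concise_factors\<close> demands. Both follow because the factor spans are the least
  solution, contained factor by factor in every other one.\<close>

lemma minimal_factor_spans:
  assumes "w \<noteq> 0" and rank: "xrank (segre ` multiproj_space ns) (pt w) = 2"
    and d: "decomposition ns w us vs"
  shows "minimal_multiproj_subspace ns (pt w) Ls \<longleftrightarrow> Ls = factor_spans us vs"
proof -
  let ?F = "factor_spans us vs"
  have us: "representatives ns us" and vs: "representatives ns vs" and w: "w = tensor us + tensor vs"
    using d by (auto simp: decomposition_def)
  have len: "length us = length ns" "length vs = length ns" using us vs by (auto simp: representatives_def)
  have coord: "fun_space.span {us ! i, vs ! i} \<subseteq> coord_space {..ns ! i}" if "i < length ns" for i
    using us vs that by (intro fun_space.span_minimal subspace_coord_space) (auto simp: representatives_def)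
  have F: "multiproj_subspace ns ?F"
    using len coord by (auto simp: multiproj_subspace_def list_all2_conv_all_nth linear_subspace_def
        proj_space_def intro: fun_space.subspace_span dest!: proj_of_mono)
  have "tensor us \<in> segre (map pt us)" "tensor vs \<in> segre (map pt vs)"
    by (simp_all add: segre_representatives fun_space.span_base)
  then have "tensor us \<in> \<Union>(segre ` listset ?F)" "tensor vs \<in> \<Union>(segre ` listset ?F)"
    using representatives_mem_factor_spans[OF us vs] by blast+
  then have "w \<in> fun_space.span (\<Union>(segre ` listset ?F))"
    unfolding w by (intro fun_space.span_add fun_space.span_base)
  then have q: "pt w \<in> proj_span (segre ` listset ?F)"
    using \<open>w \<noteq> 0\<close> unfolding pt_mem_proj_span_iff by blast
  \<comment> \<open>Leastness: each factor of a competitor contains both vectors at its position,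
    hence their span.\<close>
  have sub: "list_all2 (\<subseteq>) ?F Ms"
    if Ms: "multiproj_subspace ns Ms" "pt w \<in> proj_span (segre ` listset Ms)" for Ms
    unfolding list_all2_conv_all_nth
  proof (intro conjI allI impI)
    show l: "length ?F = length Ms" using Ms len by (auto simp: multiproj_subspace_def list_all2_conv_all_nth)
    fix i assume "i < length ?F"
    then have i: "i < length ns" using len by simp
    then have "linear_subspace (Ms ! i)" using Ms by (auto simp: multiproj_subspace_def list_all2_conv_all_nth)
    then obtain W where W: "fun_space.subspace W" "Ms ! i = proj_of W" by (auto simp: linear_subspace_def)
    have "us ! i \<in> W" "vs ! i \<in> W"
      using decomposition_mem_factor[OF assms(1) rank d Ms(2) _ i W(2,1)] l len by auto
    then have "fun_space.span {us ! i, vs ! i} \<subseteq> W"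
      using W by (intro fun_space.span_minimal) auto
    then show "?F ! i \<subseteq> Ms ! i"
      using i len W by (simp add: proj_of_mono)
  qed
  have "Ms = ?F" if Ms: "multiproj_subspace ns Ms" "pt w \<in> proj_span (segre ` listset Ms)"
      "listset Ms \<subseteq> listset ?F" for Ms
  proof (rule nth_equalityI)
    note s = sub[OF Ms(1,2)]
    show l: "length Ms = length ?F" using s by (simp add: list_all2_lengthD)
    fix i assume i: "i < length Ms"
    have "map pt us \<in> listset Ms"
      using representatives_mem_factor_spans(1)[OF us vs] listset_mono[OF s] by blast
    from listset_subset_nth[OF Ms(3) this i] have "Ms ! i \<subseteq> ?F ! i" .
    moreover have "?F ! i \<subseteq> Ms ! i" using s i l by (simp add: list_all2_nthD)
    ultimately show "Ms ! i = ?F ! i" by blast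
  qed
  then have "minimal_multiproj_subspace ns (pt w) ?F"
    using F q by (simp add: minimal_multiproj_subspace_def)
  moreover have "Ls = ?F" if "minimal_multiproj_subspace ns (pt w) Ls"
    using that F q sub[of Ls] listset_mono[of ?F Ls] by (auto simp: minimal_multiproj_subspace_def)
  ultimately show ?thesis by blast
qed

lemma is_singleton_proj_of_span_pair:
  assumes "u \<noteq> 0" "v \<noteq> 0"
  shows "is_singleton (proj_of (fun_space.span {u, v})) \<longleftrightarrow> \<not> nonprop u v"
proof
  assume "is_singleton (proj_of (fun_space.span {u, v}))"
  moreover have "pt u \<in> proj_of (fun_space.span {u, v})" "pt v \<in> proj_of (fun_space.span {u, v})"
    using assms by (simp_all add: pt_mem_proj_of_iff fun_space.span_base)
  ultimately have "pt u = pt v" by (auto simp: is_singleton_def)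
  then show "\<not> nonprop u v" using assms pt_eq_pt_iff by blast
next
  assume "\<not> nonprop u v"
  then obtain c where c: "u = vscale c v" using assms not_nonpropE by blast
  have "pt x = pt v" if x: "x \<in> fun_space.span {u, v}" "x \<noteq> 0" for x
  proof -
    obtain a b where "x = vscale a u + vscale b v" using x mem_span_pair by blast
    then have "x = vscale (a * c + b) v" by (simp add: c vscale_def fun_eq_iff algebra_simps)
    then show ?thesis using x(2) span_vscale[of "a * c + b" v] assms(2) by (cases "a * c + b = 0") auto
  qed
  moreover have "pt v \<in> proj_of (fun_space.span {u, v})"
    using assms by (simp add: pt_mem_proj_of_iff fun_space.span_base)
  ultimately have "proj_of (fun_space.span {u, v}) = {pt v}"
    by (auto simp: proj_of_def)
  then show "is_singleton (proj_of (fun_space.span {u, v}))" by simp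
qed

lemma projective_line_span_pair:
  assumes "nonprop u v"
  shows "projective_line (proj_of (fun_space.span {u, v}))"
proof -
  have "u \<noteq> v" using assms by (auto simp: nonprop_def)
  have "u \<notin> fun_space.span {v}"
    using assms fun_space.span_singleton[of v] by (auto simp: not_nonprop_vscale)
  moreover have "v \<noteq> 0" using nonprop_neq_0[OF assms] by blast
  ultimately have "fun_space.independent {u, v}"
    using \<open>u \<noteq> v\<close> by (simp add: fun_space.independent_insert)
  then have "fun_space.dim (fun_space.span {u, v}) = 2"
    using \<open>u \<noteq> v\<close> by (simp add: fun_space.dim_eq_card_independent)
  then show ?thesis
    unfolding projective_line_def by (intro exI[of _ "fun_space.span {u, v}"]) simp
qed

text \<open>The number of factors can be read off the image: a nonzero tensor is supported on
  multi-indices whose length is that number.\<close>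

lemma segre_eq_imp_length_eq:
  assumes "segre ` listset Fs = segre ` listset Gs" and "map pt vs \<in> listset Fs"
    and nz: "\<And>i. i < length vs \<Longrightarrow> vs ! i \<noteq> 0"
  shows "length Fs = length Gs"
proof -
  have lF: "length Fs = length vs" using assms(2) by (auto simp: mem_listset_iff list_all2_conv_all_nth)
  obtain p where p: "p \<in> listset Gs" "segre (map pt vs) = segre p" using assms(1,2) by blast
  then have lG: "length p = length Gs" by (auto simp: mem_listset_iff list_all2_conv_all_nth)
  have "tensor vs \<noteq> 0" using nz by (rule tensor_neq_0)
  then obtain as where as: "tensor vs as \<noteq> 0" by (auto simp: fun_eq_iff)
  let ?V = "coord_space {as. length as = length p} :: (nat list \<Rightarrow> 'a) set"
  have "tensor vs \<in> segre p" unfolding p(2)[symmetric] segre_representatives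
    by (simp add: fun_space.span_base)
  moreover have "segre p \<subseteq> ?V" unfolding segre_def
  proof (rule fun_space.span_minimal[OF _ subspace_coord_space], rule image_subsetI)
    fix ts assume "ts \<in> listset p"
    then have "length ts = length p" by (auto simp: mem_listset_iff list_all2_conv_all_nth)
    then show "tensor ts \<in> ?V" by (auto simp: coord_space_def tensor_eq_0)
  qed
  ultimately have "tensor vs \<in> ?V" by blast
  then have "length as = length p" using as by (auto simp: coord_space_def)
  moreover have "length as = length vs" using as tensor_eq_0 by blast
  ultimately show ?thesis using lF lG by simp
qed

text \<open>Every factor surviving the removal of points is already a line, so only the number of
  survivors has to be compared with 2.\<close>

lemma is_segre_P1_P1_iff:
  assumes "w \<noteq> 0" and rank: "xrank (segre ` multiproj_space ns) (pt w) = 2"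
    and d: "decomposition ns w us vs"
  shows "is_segre_P1_P1 (concise_segre ns (pt w)) \<longleftrightarrow> card (nonprop_positions us vs) = 2"
proof -
  have us: "representatives ns us" and vs: "representatives ns vs" using d by (auto simp: decomposition_def)
  have len: "length us = length ns" "length vs = length ns" using us vs by (auto simp: representatives_def)
  define line :: "(nat \<Rightarrow> 'a) \<times> (nat \<Rightarrow> 'a) \<Rightarrow> (nat, 'a) point set"
    where "line = (\<lambda>(u, v). proj_of (fun_space.span {u, v}))"
  \<comment> \<open>Keeping the pairs of vectors instead of the factors leaves a nonzero
    representative at hand on each remaining line.\<close>
  define ps where "ps = filter (\<lambda>(u, v). nonprop u v) (zip us vs)"
  have "concise_factors ns (pt w) = factor_spans us vs"
    unfolding concise_factors_def minimal_factor_spans[OF assms] by simp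
  also have "filter (\<lambda>L. \<not> is_singleton L) \<dots> = map line ps"
    unfolding factor_spans_def line_def ps_def filter_map o_def
  proof (rule arg_cong[of _ _ "map _"], rule filter_cong[OF refl])
    fix p assume "p \<in> set (zip us vs)"
    then obtain i where "i < length ns" "p = (us ! i, vs ! i)" using len by (auto simp: set_zip)
    then show "(\<not> is_singleton (case p of (u, v) \<Rightarrow> proj_of (fun_space.span {u, v}))) = (case p of (u, v) \<Rightarrow> nonprop u v)"
      using us vs by (simp add: is_singleton_proj_of_span_pair representatives_def)
  qed
  finally have X: "concise_segre ns (pt w) = segre ` listset (map line ps)"
    by (simp add: concise_segre_def)
  have "length ps = card (nonprop_positions us vs)"
    using len by (auto simp: ps_def length_filter_conv_card nonprop_positions_def intro!: arg_cong[of _ _ card])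
  moreover have "is_segre_P1_P1 (concise_segre ns (pt w)) \<longleftrightarrow> length ps = 2"
  proof
    assume "is_segre_P1_P1 (concise_segre ns (pt w))"
    then obtain L M where LM: "segre ` listset (map line ps) = segre ` listset [L, M]"
      unfolding X is_segre_P1_P1_def by blast
    have nz: "fst p \<noteq> 0" if "p \<in> set ps" for p
      using that nonprop_neq_0 by (fastforce simp: ps_def)
    have "pt (fst p) \<in> line p" if "p \<in> set ps" for p
      using nz[OF that] by (cases p) (simp add: line_def pt_mem_proj_of_iff fun_space.span_base)
    then have "map pt (map fst ps) \<in> listset (map line ps)"
      by (simp add: mem_listset_iff list_all2_conv_all_nth)
    from segre_eq_imp_length_eq[OF LM this] nz show "length ps = 2" by simp
  next
    assume "length ps = 2"
    then obtain p p' where ps: "ps = [p, p']" by (auto simp: length_Suc_conv numeral_2_eq_2)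
    have "projective_line (line p)" if "p \<in> set ps" for p
      using that by (auto simp: line_def ps_def projective_line_span_pair)
    then have "projective_line (line p)" "projective_line (line p')" using ps by auto
    then show "is_segre_P1_P1 (concise_segre ns (pt w))"
      unfolding X is_segre_P1_P1_def ps by auto
  qed
  ultimately show ?thesis by simp
qed

section \<open>Counting the decompositions\<close>

lemma decomposition_unique:
  assumes d: "decomposition ns w us vs" and d': "decomposition ns w xs ys"
    and c: "card (nonprop_positions us vs) \<ge> 3"
  shows "{map pt us, map pt vs} = {map pt xs, map pt ys}"
proof -
  have us: "representatives ns us" and vs: "representatives ns vs"
    and xs: "representatives ns xs" and ys: "representatives ns ys"
    using d d' by (auto simp: decomposition_def)
  obtain T where T: "T \<subseteq> nonprop_positions us vs" "card T = 3"
    using obtain_subset_with_card_n[OF c] by blast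
  then obtain i j l where "T = {i, j, l}" and ne: "i \<noteq> j" "i \<noteq> l" "j \<noteq> l" by (auto simp: card_3_iff)
  with T us have ijl: "i < length ns" "j < length ns" "l < length ns"
    "nonprop (us ! i) (vs ! i)" "nonprop (us ! j) (vs ! j)" "nonprop (us ! l) (vs ! l)"
    by (auto simp: nonprop_positions_def representatives_def)
  have eq: "tprod {..<length ns} ((!) us) s + tprod {..<length ns} ((!) vs) s =
      tprod {..<length ns} ((!) xs) s + tprod {..<length ns} ((!) ys) s" for s
    using decomposition_tprod[OF d, of s] decomposition_tprod[OF d', of s] by simp
  have "tprod {..<length ns} ((!) us) = tprod {..<length ns} ((!) xs) \<and>
      tprod {..<length ns} ((!) vs) = tprod {..<length ns} ((!) ys) \<or>
      tprod {..<length ns} ((!) us) = tprod {..<length ns} ((!) ys) \<and>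
      tprod {..<length ns} ((!) vs) = tprod {..<length ns} ((!) xs)"
    using us vs ijl by (intro tprod_sum_unique[OF _ _ _ _ _ _ ne _ _ _ eq]) (auto simp: representatives_def)
  then have "map pt us = map pt xs \<and> map pt vs = map pt ys \<or> map pt us = map pt ys \<and> map pt vs = map pt xs"
    using tensor_eq_imp_pt_eq us vs xs ys by blast
  then show ?thesis by auto
qed

lemma second_decomposition:
  assumes d: "decomposition ns w us vs" and c: "card (nonprop_positions us vs) = 2"
  obtains xs ys where "decomposition ns w xs ys" "{map pt xs, map pt ys} \<noteq> {map pt us, map pt vs}"
proof -
  have us: "representatives ns us" and vs: "representatives ns vs" and w: "w = tensor us + tensor vs"
    using d by (auto simp: decomposition_def)
  have len: "length us = length ns" "length vs = length ns" using us vs by (auto simp: representatives_def)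
  obtain i j where N: "nonprop_positions us vs = {i, j}" and ij: "i \<noteq> j" using c by (auto simp: card_2_iff)
  have "i \<in> nonprop_positions us vs" "j \<in> nonprop_positions us vs" using N by auto
  then have i: "i < length ns" "nonprop (us ! i) (vs ! i)" and j: "j < length ns" "nonprop (us ! j) (vs ! j)"
    using len by (auto simp: nonprop_positions_def)
  let ?J = "{..<length ns}"
  let ?R = "?J - {i} - {j}"
  have np: "\<not> nonprop (vs ! l) (us ! l)" if "l \<in> ?R" for l
  proof -
    have "l \<notin> nonprop_positions us vs" using that N by auto
    then show ?thesis using that len nonprop_sym[of "vs ! l" "us ! l"] by (auto simp: nonprop_positions_def)
  qed
  \<comment> \<open>All positions other than \<open>i\<close> and \<open>j\<close> are proportional;
    \<open>c\<close> is the ratio of the two products over them.\<close>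
  obtain c where c0: "c \<noteq> 0" and c: "tprod ?R ((!) vs) = vscale c (tprod ?R ((!) us))"
    by (rule tprod_proportional[of ?R "(!) vs" "(!) us"]) (use us vs np in \<open>auto simp: representatives_def\<close>)
  have R: "?J - {j} - {i} = ?R" by auto
  let ?x = "us ! i + vscale c (vs ! i)" and ?y = "vs ! j - us ! j"
  let ?xs = "us[i := ?x]" and ?ys = "vs[j := ?y]"
  \<comment> \<open>\<open>u\<^sub>i u\<^sub>j + c v\<^sub>i v\<^sub>j = (u\<^sub>i + c v\<^sub>i) u\<^sub>j + c v\<^sub>i (v\<^sub>j - u\<^sub>j)\<close>, times the factor common to all the other positions.\<close>
  have T: "w = tensor ?xs + tensor ?ys"
  proof
    fix as
    show "w as = (tensor ?xs + tensor ?ys) as"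
    proof (cases "length as = length ns")
      case True
      let ?s = "(!) as"
      have "tprod ?J ((!) ?xs) ?s = ?x (as ! i) * ((us ! j) (as ! j) * tprod ?R ((!) us) ?s)"
        using tprod_list_update[of i us ?x ?s] len i j ij tprod_remove[of "?J - {i}" j "(!) us" ?s] by simp
      moreover have "tprod ?J ((!) ?ys) ?s = ?y (as ! j) * ((vs ! i) (as ! i) * (c * tprod ?R ((!) us) ?s))"
        using tprod_list_update[of j vs ?y ?s] len i j ij tprod_remove[of "?J - {j}" i "(!) vs" ?s] R c
        by (simp add: vscale_def)
      moreover have "tprod ?J ((!) us) ?s = (us ! i) (as ! i) * ((us ! j) (as ! j) * tprod ?R ((!) us) ?s)"
        using i j ij tprod_remove[of ?J i "(!) us" ?s] tprod_remove[of "?J - {i}" j "(!) us" ?s] by simp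
      moreover have "tprod ?J ((!) vs) ?s = (vs ! i) (as ! i) * ((vs ! j) (as ! j) * (c * tprod ?R ((!) us) ?s))"
        using i j ij c tprod_remove[of ?J i "(!) vs" ?s] tprod_remove[of "?J - {i}" j "(!) vs" ?s]
        by (simp add: vscale_def)
      ultimately show ?thesis
        using True len by (simp add: w tensor_eq_tprod vscale_def algebra_simps)
    qed (use len in \<open>simp add: w tensor_eq_0\<close>)
  qed
  \<comment> \<open>With \<open>?D\<close> a nonzero minor of \<open>us ! i\<close> and
    \<open>vs ! i\<close>, the minors of \<open>?x\<close> with these two vectors are
    \<open>- c * ?D\<close> and \<open>?D\<close>; the first is nonzero because \<open>c\<close>
    is.\<close>
  have nx: "nonprop ?x (us ! i)" "nonprop ?x (vs ! i)"
  proof -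
    obtain s t where D: "(us ! i) s * (vs ! i) t - (us ! i) t * (vs ! i) s \<noteq> 0" (is "?D \<noteq> 0")
      using i(2) by (auto simp: nonprop_def)
    have "?x s * (us ! i) t - ?x t * (us ! i) s = - c * ?D"
      "?x s * (vs ! i) t - ?x t * (vs ! i) s = ?D"
      by (simp_all add: vscale_def algebra_simps)
    then have "?x s * (us ! i) t - ?x t * (us ! i) s \<noteq> 0" "?x s * (vs ! i) t - ?x t * (vs ! i) s \<noteq> 0"
      using D c0 by (simp_all only: mult_eq_0_iff neg_equal_0_iff_equal) auto
    then show "nonprop ?x (us ! i)" "nonprop ?x (vs ! i)" unfolding nonprop_def by auto
  qed
  have x0: "?x \<noteq> 0" and ui0: "us ! i \<noteq> 0" and vi0: "vs ! i \<noteq> 0"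
    using nonprop_neq_0[OF nx(1)] nonprop_neq_0[OF nx(2)] by auto
  have y0: "?y \<noteq> 0" using j(2) by (auto simp: nonprop_def)
  have xs: "representatives ns ?xs"
    using us vs i x0 by (intro representatives_list_update)
      (auto simp: representatives_def subspace_coord_space fun_space.subspace_add fun_space.subspace_scale)
  have ys: "representatives ns ?ys"
    using us vs j y0 by (intro representatives_list_update)
      (auto simp: representatives_def subspace_coord_space fun_space.subspace_diff)
  have px: "pt ?x \<noteq> pt (us ! i)" "pt ?x \<noteq> pt (vs ! i)"
    using pt_eq_pt_iff[OF x0 ui0] pt_eq_pt_iff[OF x0 vi0] nx by auto
  \<comment> \<open>Position \<open>i\<close> alone separates \<open>?xs\<close> from
    \<open>us\<close>, \<open>vs\<close> and \<open>?ys\<close>, since \<open>?ys\<close> still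
    carries \<open>vs ! i\<close> there.\<close>
  have "map pt ?xs ! i = pt ?x" "map pt ?ys ! i = pt (vs ! i)" "map pt us ! i = pt (us ! i)" "map pt vs ! i = pt (vs ! i)"
    using len i ij by simp_all
  then have ne: "map pt ?xs \<noteq> map pt ?ys" "map pt ?xs \<noteq> map pt us" "map pt ?xs \<noteq> map pt vs"
    using px by metis+
  show thesis
  proof (rule that)
    show "decomposition ns w ?xs ?ys" using xs ys ne(1) T by (simp only: decomposition_def simp_thms)
    show "{map pt ?xs, map pt ?ys} \<noteq> {map pt us, map pt vs}" using ne(2,3) by (simp only: doubleton_eq_iff simp_thms not_False_eq_True)
  qed
qed

text \<open>As \<open>card\<close> is 0 on infinite sets, having more than one element needs the
  extra disjunct. Two distinct elements witness it in either case.\<close>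

lemma infinite_or_card_gt_1_iff: "infinite A \<or> card A > 1 \<longleftrightarrow> (\<exists>x\<in>A. \<exists>y\<in>A. x \<noteq> y)"
proof (cases "finite A")
  case True
  then show ?thesis using card_le_Suc0_iff_eq[of A] by (auto simp: not_le[symmetric])
next
  case False
  then obtain x where "x \<in> A" by (metis finite.emptyI ex_in_conv)
  moreover have "\<not> A \<subseteq> {x}" using False finite_subset by blast
  ultimately show ?thesis using False by blast
qed

theorem proposition2p3:
  fixes ns :: "nat list"
    and q :: "(nat list, 'a::{alg_closed_field, field_char_0}) point"
  assumes "q \<in> sigma2_0 ns"
  shows "(infinite (evincing_sets ns q) \<or> card (evincing_sets ns q) > 1) \<longleftrightarrow>
         is_segre_P1_P1 (concise_segre ns q)"
proof -
  obtain w where w: "w \<in> coord_space (listset (map (\<lambda>n. {..n}) ns))" "w \<noteq> 0" and q: "q = pt w"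
    and rank: "xrank (segre ` multiproj_space ns) (pt w) = 2"
    using assms by (auto simp: sigma2_0_def segre_ambient_def proj_of_def)
  obtain us vs where d: "decomposition ns w us vs" by (rule decomposition_exists[OF w rank])
  note ev = mem_evincing_sets_iff[OF w(2) rank]
  \<comment> \<open>There are always at least two positions with independent vectors, so the
    alternative to exactly two is at least three, where every evincing set equals the one given by
    \<open>us\<close> and \<open>vs\<close>.\<close>
  have "(\<exists>A\<in>evincing_sets ns q. \<exists>B\<in>evincing_sets ns q. A \<noteq> B) \<longleftrightarrow> card (nonprop_positions us vs) = 2"
  proof
    assume "\<exists>A\<in>evincing_sets ns q. \<exists>B\<in>evincing_sets ns q. A \<noteq> B"
    then obtain A B where AB: "A \<in> evincing_sets ns q" "B \<in> evincing_sets ns q" "A \<noteq> B" by blast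
    have "C = {map pt us, map pt vs}" if "C \<in> evincing_sets ns q" "card (nonprop_positions us vs) \<ge> 3" for C
      using that decomposition_unique[OF d] unfolding q ev by blast
    with AB have "\<not> card (nonprop_positions us vs) \<ge> 3" by blast
    then show "card (nonprop_positions us vs) = 2"
      using card_nonprop_positions_ge_2[OF w(2) rank d] by linarith
  next
    assume "card (nonprop_positions us vs) = 2"
    then obtain xs ys where "decomposition ns w xs ys" "{map pt xs, map pt ys} \<noteq> {map pt us, map pt vs}"
      by (rule second_decomposition[OF d])
    then show "\<exists>A\<in>evincing_sets ns q. \<exists>B\<in>evincing_sets ns q. A \<noteq> B"
      using d unfolding q by (intro bexI[of _ "{map pt xs, map pt ys}"] bexI[of _ "{map pt us, map pt vs}"])
        (auto simp only: ev)
  qed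
  then show ?thesis
    unfolding infinite_or_card_gt_1_iff q is_segre_P1_P1_iff[OF w(2) rank d] .
qed

end
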